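(* For all non-negative integers $m,n$ we have $$B_{m+n}=\sum_{\substack{0\leq k \leq n \\ 0\leq l \leq m}}\frac{(-1)^{k+l}\, k!\, l!\, S(n,k)\,S(m,l)}{(k+l+1)\,\binom{k+l}{l}},$$ where $B_{j}$ denotes the $j$-th Bernoulli number and $S(n,k)$ denotes the Stirling number of the second kind.
   Context: The Bernoulli numbers $B_n$ ($n\ge 0$) are the rational numbers defined by the generating function $\frac{t}{e^{t}-1}=\sum_{n\geq 0}\frac{B_{n}t^{n}}{n!}$ for $|t|<2\pi$ (so $B_0=1$ and $B_1=-\tfrac12$). The Stirling number of the second kind $S(n,k)$, for non-negative integers $n,k$, is the number of ways of partitioning a set of $n$ elements into $k$ nonempty sets (so $S(0,0)=1$ and $S(n,0)=0$ for $n\ge 1$). *)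

theory Defs
  imports "HOL-Complex_Analysis.Complex_Analysis" "HOL-Combinatorics.Stirling"
begin

definition bernoulli :: "nat \<Rightarrow> rat" where
  "bernoulli n = fact n * fps_nth (fps_X / (fps_exp 1 - 1)) n"

text \<open>
  The formal quotient above is an actual power series because \<open>exp t - 1\<close> has subdegree 1.
  \<open>bernoulli_sums\<close> is the analytic form of the generating function; at \<open>t = 0\<close> the
  quotient has a removable singularity with value 1.
\<close>

lemma bernoulli_gf: "Abs_fps (\<lambda>n. bernoulli n / fact n) = fps_X / (fps_exp 1 - 1)"
  by (simp add: fps_eq_iff bernoulli_def)

lemma subdegree_fps_exp_minus_1: "subdegree (fps_exp 1 - 1 :: 'a :: field_char_0 fps) = 1"
  by (rule subdegreeI) auto

lemma bernoulli_gf_mult: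
  "Abs_fps (\<lambda>n. bernoulli n / fact n) * (fps_exp 1 - 1) = fps_X"
proof -
  have "(fps_exp 1 - 1 :: rat fps) dvd fps_X"
    using subdegree_fps_exp_minus_1[where 'a = rat]
    by (subst fps_dvd_iff) auto
  thus ?thesis
    unfolding bernoulli_gf by simp
qed

lemma bernoulli_0: "bernoulli 0 = 1"
proof -
  have "fps_nth (Abs_fps (\<lambda>n. bernoulli n / fact n) * (fps_exp 1 - 1)) 1 = 1"
    unfolding bernoulli_gf_mult by simp
  thus ?thesis
    by (simp add: fps_mult_nth)
qed

lemma bernoulli_1: "bernoulli 1 = - 1 / 2"
proof -
  have "fps_nth (Abs_fps (\<lambda>n. bernoulli n / fact n) * (fps_exp 1 - 1)) 2 = 0"
    unfolding bernoulli_gf_mult by simp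
  thus ?thesis
    by (simp add: fps_mult_nth eval_nat_numeral bernoulli_0 field_simps)
qed

lemma bernoulli_gf_complex:
  "Abs_fps (\<lambda>n. of_rat (bernoulli n) / fact n) = (fps_X / (fps_exp 1 - 1) :: complex fps)"
proof -
  let ?G = "Abs_fps (\<lambda>n. of_rat (bernoulli n) / fact n) :: complex fps"
  have of_rat_fact: "of_rat (fact n) = (fact n :: complex)" for n
    by (metis of_nat_fact of_rat_of_nat_eq)
  have "fps_nth (?G * (fps_exp 1 - 1)) n = fps_nth fps_X n" for n
  proof -
    have "fps_nth (?G * (fps_exp 1 - 1)) n =
          of_rat (fps_nth (Abs_fps (\<lambda>n. bernoulli n / fact n) * (fps_exp 1 - 1)) n)"
      unfolding fps_mult_nth of_rat_sum
      by (intro sum.cong) (auto simp: of_rat_mult of_rat_divide of_rat_fact of_rat_diff)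
    also have "\<dots> = fps_nth fps_X n"
      unfolding bernoulli_gf_mult by (simp add: fps_X_def)
    finally show ?thesis .
  qed
  hence "?G * (fps_exp 1 - 1) = fps_X"
    by (simp add: fps_eq_iff)
  moreover have "(fps_exp 1 - 1 :: complex fps) \<noteq> 0"
    using subdegree_fps_exp_minus_1[where 'a = complex] by fastforce
  ultimately show ?thesis
    by (metis nonzero_mult_div_cancel_right)
qed

lemma bernoulli_sums:
  fixes t :: complex
  assumes "norm t < 2 * pi"
  shows "(\<lambda>n. of_rat (bernoulli n) * t ^ n / fact n) sums (if t = 0 then 1 else t / (exp t - 1))"
proof -
  define f :: "complex \<Rightarrow> complex" where "f = (\<lambda>z. if z = 0 then 1 else z / (exp z - 1))"
  have nz: "(fps_exp 1 - 1 :: complex fps) \<noteq> 0"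
    using subdegree_fps_exp_minus_1[where 'a = complex] by fastforce
  have "(\<lambda>z::complex. exp (1 * z) - 1) has_fps_expansion (fps_exp 1 - 1)"
    by (intro fps_expansion_intros)
  hence e: "(\<lambda>z::complex. exp z - 1) has_fps_expansion (fps_exp 1 - 1)"
    by simp
  have expansion: "f has_fps_expansion (fps_X / (fps_exp 1 - 1))"
    unfolding f_def
    by (rule has_fps_expansion_divide)
       (use e nz subdegree_fps_exp_minus_1[where 'a = complex] in \<open>auto intro: fps_expansion_intros\<close>)
  have ne: "exp z \<noteq> 1" if "norm z < 2 * pi" "z \<noteq> 0" for z :: complex
  proof
    assume "exp z = 1"
    then obtain n :: int where n: "Re z = 0" "Im z = of_int (2 * n) * pi"
      by (auto simp: exp_eq_1)
    with \<open>z \<noteq> 0\<close> have "n \<noteq> 0"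
      by (auto simp: complex_eq_iff)
    hence "1 \<le> \<bar>real_of_int n\<bar>"
      by linarith
    hence "2 * pi \<le> \<bar>Im z\<bar>"
      using n by (simp add: abs_mult)
    thus False
      using abs_Im_le_cmod[of z] that by linarith
  qed
  have "f holomorphic_on ball 0 (2 * pi) - {0}"
  proof (rule holomorphic_transform)
    show "(\<lambda>z. z / (exp z - 1)) holomorphic_on ball 0 (2 * pi) - {0}"
      using ne by (auto intro!: holomorphic_intros)
  qed (auto simp: f_def)
  moreover have "isCont f 0"
    using has_fps_expansion_imp_continuous[OF expansion, of UNIV] by simp
  ultimately have "continuous_on (ball 0 (2 * pi)) f" "f holomorphic_on ball 0 (2 * pi) - {0}"
    using continuous_on_eq_continuous_at[of "ball 0 (2 * pi) - {0}" f]
          continuous_on_eq_continuous_at[of "ball 0 (2 * pi)" f]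
          holomorphic_on_imp_continuous_on[of f "ball 0 (2 * pi) - {0}"]
    by (auto simp: open_Diff)
  hence "f holomorphic_on ball 0 (2 * pi)"
    by (rule no_isolated_singularity) auto
  hence "(\<lambda>n. (deriv ^^ n) f 0 / fact n * (t - 0) ^ n) sums f t"
    by (rule holomorphic_power_series) (use assms in auto)
  moreover have "(deriv ^^ n) f 0 / fact n = of_rat (bernoulli n) / fact n" for n
    using fps_nth_fps_expansion[OF expansion, of n]
    unfolding bernoulli_gf_complex[symmetric] by simp
  ultimately show ?thesis
    by (simp add: f_def)
qed

text \<open>
  \<^const>\<open>Stirling\<close> is defined by its recurrence; it counts partitions into \<open>k\<close> nonempty blocks.
\<close>

lemma card_partitions_insert:
  assumes "finite A" "a \<notin> A"
  defines "S \<equiv> \<lambda>A k. {P. partition_on A P \<and> card P = k}"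
  shows "card (S (insert a A) (Suc k)) = Suc k * card (S A (Suc k)) + card (S A k)"
proof -
  have fin: "finite (S B k)" if "finite B" for B k
    using finitely_many_partition_on[OF that] by (rule rev_finite_subset) (auto simp: S_def)
  have finP: "finite P" if "P \<in> S B k" "finite B" for P B k
    using that finite_elements by (auto simp: S_def)
  define X where "X = {Q \<in> S (insert a A) (Suc k). {a} \<in> Q}"
  define Y where "Y = {Q \<in> S (insert a A) (Suc k). {a} \<notin> Q}"
  have XY: "S (insert a A) (Suc k) = X \<union> Y" "X \<inter> Y = {}" "finite X" "finite Y"
    using fin[of "insert a A" "Suc k"] \<open>finite A\<close> by (auto simp: X_def Y_def)
  have "bij_betw (insert {a}) (S A k) X"
  proof (rule bij_betw_byWitness[where f' = "\<lambda>Q. Q - {{a}}"])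
    have notin: "{a} \<notin> P" if "P \<in> S A k" for P
      using that \<open>a \<notin> A\<close> by (auto simp: S_def partition_on_def)
    thus "\<forall>P\<in>S A k. insert {a} P - {{a}} = P"
      by auto
    show "\<forall>Q\<in>X. insert {a} (Q - {{a}}) = Q"
      by (auto simp: X_def)
    show "insert {a} ` S A k \<subseteq> X"
    proof safe
      fix P assume P: "P \<in> S A k"
      have "partition_on (insert a A) (insert {a} P)"
        using P \<open>a \<notin> A\<close> by (subst partition_on_insert) (auto simp: S_def partition_on_def disjnt_def)
      thus "insert {a} P \<in> X"
        using P notin[OF P] finP[OF P \<open>finite A\<close>] by (auto simp: X_def S_def)
    qed
    show "(\<lambda>Q. Q - {{a}}) ` X \<subseteq> S A k"
    proof safe
      fix Q assume Q: "Q \<in> X"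
      have part: "partition_on (insert a A) Q" and aQ: "{a} \<in> Q"
        using Q by (auto simp: X_def S_def)
      have dis: "disjnt {a} (\<Union>(Q - {{a}}))"
        using part aQ by (fastforce simp: partition_on_def disjnt_def pairwise_def)
      have "partition_on (insert a A) (insert {a} (Q - {{a}}))"
        using part aQ by (simp add: insert_absorb)
      hence "partition_on A (Q - {{a}})"
        using partition_on_insert[OF dis] \<open>a \<notin> A\<close> by simp
      thus "Q - {{a}} \<in> S A k"
        using Q finP[of Q "insert a A" "Suc k"] \<open>finite A\<close> by (auto simp: X_def S_def)
    qed
  qed
  hence cX: "card X = card (S A k)"
    by (metis bij_betw_same_card)
  define g where "g = (\<lambda>(P, p). insert (insert a p) (P - {p}))"
  define b where "b = (\<lambda>Q. THE q. q \<in> Q \<and> a \<in> q)"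
  have b_eq: "b Q = q" if "partition_on B Q" "q \<in> Q" "a \<in> q" for Q q B
    unfolding b_def
    by (rule the_equality)
       (use that in \<open>auto simp: partition_on_def pairwise_def disjnt_def\<close>)
  define h where "h = (\<lambda>Q. (insert (b Q - {a}) (Q - {b Q}), b Q - {a}))"
  let ?D = "SIGMA P:S A (Suc k). P"
  have g_props: "partition_on (insert a A) (g (P, p)) \<and> b (g (P, p)) = insert a p \<and>
                 insert a p \<notin> P \<and> a \<notin> p \<and> p \<noteq> {}"
    if P: "P \<in> S A (Suc k)" and p: "p \<in> P" for P p
  proof -
    have part: "partition_on A P"
      using P by (simp add: S_def)
    have anp: "a \<notin> q" if "q \<in> P" for q
      using part that \<open>a \<notin> A\<close> by (auto simp: partition_on_def)
    have dis: "disjnt p (\<Union>(P - {p}))"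
      using part p by (fastforce simp: partition_on_def disjnt_def pairwise_def)
    have "partition_on A (insert p (P - {p}))"
      using part p by (simp add: insert_absorb)
    hence pA: "partition_on (A - p) (P - {p})" "p \<subseteq> A" "p \<noteq> {}"
      using partition_on_insert[OF dis] by auto
    have dis': "disjnt (insert a p) (\<Union>(P - {p}))"
      using dis anp by (auto simp: disjnt_def)
    have "insert a A - insert a p = A - p"
      using \<open>a \<notin> A\<close> by auto
    hence *: "partition_on (insert a A) (g (P, p))"
      unfolding g_def prod.case partition_on_insert[OF dis'] using pA by auto
    moreover have "b (g (P, p)) = insert a p"
      by (rule b_eq[OF *]) (auto simp: g_def)
    ultimately show ?thesis
      using anp[of p] anp[of "insert a p"] p pA by (intro conjI notI) auto
  qed
  have h_props: "b Q \<in> Q \<and> a \<in> b Q \<and> b Q - {a} \<noteq> {} \<and> b Q - {a} \<notin> Q \<and>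
                 partition_on A (insert (b Q - {a}) (Q - {b Q}))"
    if Q: "Q \<in> Y" for Q
  proof -
    have part: "partition_on (insert a A) Q" and aQ: "{a} \<notin> Q"
      using Q by (auto simp: Y_def S_def)
    obtain q where q: "q \<in> Q" "a \<in> q"
      using part by (auto simp: partition_on_def)
    have bq: "b Q = q"
      using b_eq[OF part q] .
    have ne: "q - {a} \<noteq> {}"
      using q aQ by (metis Diff_eq_empty_iff subset_singletonD empty_iff)
    have dis: "disjnt q (\<Union>(Q - {q}))"
      using part q by (fastforce simp: partition_on_def disjnt_def pairwise_def)
    have "partition_on (insert a A) (insert q (Q - {q}))"
      using part q by (simp add: insert_absorb)
    hence qA: "partition_on (insert a A - q) (Q - {q})" "q \<subseteq> insert a A"
      using partition_on_insert[OF dis] by auto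
    have dis': "disjnt (q - {a}) (\<Union>(Q - {q}))"
      using dis by (auto simp: disjnt_def)
    have "A - (q - {a}) = insert a A - q"
      using \<open>a \<notin> A\<close> q by auto
    hence "partition_on A (insert (q - {a}) (Q - {q}))"
      unfolding partition_on_insert[OF dis'] using qA ne by auto
    moreover have "q - {a} \<notin> Q"
    proof
      assume "q - {a} \<in> Q"
      with q have "q - {a} \<subseteq> \<Union>(Q - {q})"
        by blast
      with dis ne show False
        unfolding disjnt_def by blast
    qed
    ultimately show ?thesis
      using bq q ne by simp
  qed
  have "bij_betw g ?D Y"
  proof (rule bij_betw_byWitness[where f' = h])
    show "\<forall>x\<in>?D. h (g x) = x"
    proof safe
      fix P p assume "P \<in> S A (Suc k)" "p \<in> P"
      note gp = g_props[OF this]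
      have "g (P, p) - {insert a p} = P - {p}"
        using gp by (auto simp: g_def)
      moreover have "insert a p - {a} = p"
        using gp by auto
      ultimately show "h (g (P, p)) = (P, p)"
        using gp \<open>p \<in> P\<close> by (simp add: h_def insert_absorb)
    qed
    show "\<forall>Q\<in>Y. g (h Q) = Q"
    proof
      fix Q assume "Q \<in> Y"
      from h_props[OF this] show "g (h Q) = Q"
        by (auto simp: g_def h_def insert_absorb)
    qed
    show "g ` ?D \<subseteq> Y"
    proof safe
      fix P p assume P: "P \<in> S A (Suc k)" and p: "p \<in> P"
      note gp = g_props[OF P p]
      have "card (g (P, p)) = Suc k"
        using gp P p finP[OF P \<open>finite A\<close>] by (simp add: g_def S_def)
      moreover have "{a} \<notin> g (P, p)"
        using gp b_eq[of "insert a A" "g (P, p)" "{a}"] by auto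
      ultimately show "g (P, p) \<in> Y"
        using gp by (auto simp: Y_def S_def)
    qed
    show "h ` Y \<subseteq> ?D"
    proof (rule image_subsetI)
      fix Q assume Q: "Q \<in> Y"
      note hp = h_props[OF Q]
      have cardQ: "card Q = Suc k" "finite Q"
        using Q finP[of Q "insert a A" "Suc k"] \<open>finite A\<close> by (auto simp: Y_def S_def)
      have "card (insert (b Q - {a}) (Q - {b Q})) = Suc k"
        using hp cardQ by simp
      thus "h Q \<in> ?D"
        using hp by (auto simp: h_def S_def)
    qed
  qed
  hence "card Y = card ?D"
    by (metis bij_betw_same_card)
  also have "\<dots> = (\<Sum>P\<in>S A (Suc k). card P)"
    using fin \<open>finite A\<close> finP by (subst card_SigmaI) auto
  also have "\<dots> = (\<Sum>P\<in>S A (Suc k). Suc k)"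
    by (rule sum.cong) (auto simp: S_def)
  also have "\<dots> = Suc k * card (S A (Suc k))"
    by simp
  finally have "card Y = Suc k * card (S A (Suc k))" .
  with cX XY show ?thesis
    by (simp add: card_Un_disjoint)
qed

lemma Stirling_eq_card_partitions:
  assumes "finite A"
  shows "Stirling (card A) k = card {P. partition_on A P \<and> card P = k}"
  using assms
proof (induction A arbitrary: k rule: finite_induct)
  case empty
  have "{P::'a set set. P = {} \<and> card P = k} = (if k = 0 then {{}} else {})"
    by auto
  thus ?case
    by (cases k) (auto simp: partition_on_empty)
next
  case (insert a A)
  show ?case
  proof (cases k)
    case 0
    have "P = {}" if "partition_on (insert a A) P" "card P = 0" for P
      using that finite_elements[of "insert a A" P] insert.hyps by auto
    hence none: "{P. partition_on (insert a A) P \<and> card P = 0} = {}"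
      by (auto simp: partition_on_def)
    thus ?thesis
      using insert.hyps unfolding 0 none by simp
  next
    case (Suc j)
    thus ?thesis
      using insert.hyps card_partitions_insert[of A a j] by (simp add: insert.IH)
  qed
qed

end

theory Submission
  imports Defs
begin

text \<open>
  Write \<open>T n m\<close> for the double sum and \<open>c k l\<close> for the factor that multiplies
  \<open>Stirling n k * Stirling m l\<close> in it, so that
  \<open>c k l = (-1)^(k+l) * (k!)^2 * (l!)^2 / (k+l+1)!\<close>. The idea is that \<open>T n m\<close> depends only
  on \<open>n + m\<close>: the recurrence of the Stirling numbers turns \<open>T (n+1) m\<close> into a sum with the
  indices of \<open>T n m\<close> in which \<open>c k l\<close> is replaced by \<open>k * c k l + c (k+1) l\<close>
  (\<open>sum_Stirling_Suc\<close>), and it turns \<open>T n (m+1)\<close> into the one with \<open>l * c k l + c k (l+1)\<close>.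
  These two weights agree (\<open>weight_exchange\<close>), so \<open>T (n+1) m = T n (m+1)\<close>.

  Behind this is an integration by parts. The beta integral writes \<open>T n m\<close> as the integral of
  \<open>P\<^sub>n(x) P\<^sub>m(1-x)\<close> over \<open>[0,1]\<close> with \<open>P\<^sub>n(x) = \<Sum>k. Stirling n k * k! * (-x)^k\<close>; since
  \<open>P\<^sub>n\<^sub>+\<^sub>1(x) = x * d/dx ((1-x) P\<^sub>n(x))\<close>, integration by parts moves one unit of index from one
  factor to the other, and the boundary terms vanish because of the factor \<open>x(1-x)\<close>.

  It remains to see that \<open>T n 0 = \<Sum>k. (-1)^k * k! * Stirling n k / (k+1)\<close> is the Bernoulli
  number (\<open>bernoulli_eq_sum_Stirling\<close>). This is the substitution \<open>u = exp t - 1\<close> in the series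
  \<open>ln (1+u) / u = \<Sum>k. (-1)^k * u^k / (k+1)\<close>, since \<open>(exp t - 1)^k\<close> is the exponential
  generating function of \<open>k! * Stirling n k\<close>.
\<close>

section \<open>Bernoulli numbers as a single sum over Stirling numbers\<close>

text \<open>
  The derivative of \<open>(exp t - 1)^(k+1)\<close> is \<open>(k+1) * ((exp t - 1)^(k+1) + (exp t - 1)^k)\<close>;
  comparing coefficients, this is the recurrence of the Stirling numbers.
\<close>

lemma fps_nth_exp_minus_1_power:
  "fps_nth ((fps_exp 1 - 1 :: 'a :: field_char_0 fps) ^ k) n = fact k * of_nat (Stirling n k) / fact n"
proof (induction n arbitrary: k)
  case 0
  show ?case by (cases k) (auto simp: fps_power_zeroth)
next
  case (Suc n)
  show ?case
  proof (cases k)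
    case 0
    thus ?thesis by simp
  next
    case (Suc j)
    let ?E = "fps_exp 1 - 1 :: 'a fps"
    have "fps_deriv (?E ^ Suc j) = of_nat (Suc j) * (?E ^ Suc j + ?E ^ j)"
      by (subst fps_deriv_power') (simp add: algebra_simps)
    hence "fps_nth (fps_deriv (?E ^ Suc j)) n
             = of_nat (Suc j) * (fps_nth (?E ^ Suc j) n + fps_nth (?E ^ j) n)"
      by (metis fps_mult_left_const_nth fps_of_nat fps_add_nth)
    also have "\<dots> = fact (Suc j) * of_nat (Stirling (Suc n) (Suc j)) / fact n"
      unfolding Suc.IH by (simp add: field_simps)
    finally show ?thesis
      using Suc by (simp add: field_simps del: power_Suc of_nat_Suc Stirling.simps)
  qed
qed

text \<open>
  Since \<open>ln (1 + u)\<close> is the compositional inverse of \<open>exp t - 1\<close>, substituting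
  \<open>u = exp t - 1\<close> into \<open>ln (1 + u) = u * L(u)\<close> gives \<open>t = (exp t - 1) * L(exp t - 1)\<close>, so
  that \<open>L(exp t - 1)\<close> is the generating function of the Bernoulli numbers.
\<close>

lemma bernoulli_eq_sum_Stirling:
  "bernoulli n = (\<Sum>k\<le>n. (-1) ^ k * fact k * of_nat (Stirling n k) / of_nat (k + 1))"
proof -
  let ?E = "fps_exp 1 - 1 :: rat fps"
  define L :: "rat fps" where "L = Abs_fps (\<lambda>k. (-1) ^ k / of_nat (k + 1))"
  have "fps_ln 1 = fps_X * L"
    by (rule fps_ext) (auto simp: L_def fps_ln_nth gr0_conv_Suc)
  moreover have "fps_ln 1 oo ?E = fps_X"
    by (simp add: fps_ln_fps_exp_inv fps_inv)
  ultimately have "(L oo ?E) * ?E = fps_X"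
    by (simp add: fps_compose_mult_distrib mult.commute)
  moreover have "?E \<noteq> 0"
    using subdegree_fps_exp_minus_1[where 'a = rat] by fastforce
  ultimately have "fps_X / ?E = L oo ?E"
    by (metis nonzero_mult_div_cancel_right)
  thus ?thesis
    by (simp add: bernoulli_def fps_compose_nth fps_nth_exp_minus_1_power L_def
        sum_distrib_left atLeast0AtMost mult.assoc)
qed

section \<open>Moving one unit of index between the two Stirling numbers\<close>

text \<open>
  Summation by parts: the recurrence of the Stirling numbers, transposed to act on the function
  that they are summed against.
\<close>

lemma sum_Stirling_Suc:
  fixes f :: "nat \<Rightarrow> 'a :: comm_semiring_1"
  shows "(\<Sum>k\<le>Suc n. of_nat (Stirling (Suc n) k) * f k)
           = (\<Sum>k\<le>n. of_nat (Stirling n k) * (of_nat k * f k + f (Suc k)))"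
proof -
  have "(\<Sum>k\<le>Suc n. of_nat (Stirling (Suc n) k) * f k)
          = (\<Sum>k\<le>n. of_nat (Suc k * Stirling n (Suc k)) * f (Suc k))
            + (\<Sum>k\<le>n. of_nat (Stirling n k) * f (Suc k))"
    by (subst sum.atMost_Suc_shift) (simp add: algebra_simps sum.distrib)
  also have "(\<Sum>k\<le>n. of_nat (Suc k * Stirling n (Suc k)) * f (Suc k))
               = (\<Sum>k\<le>Suc n. of_nat (k * Stirling n k) * f k)"
    by (subst sum.atMost_Suc_shift) simp
  also have "\<dots> = (\<Sum>k\<le>n. of_nat (k * Stirling n k) * f k)"
    by simp
  finally show ?thesis
    by (simp add: algebra_simps sum.distrib)
qed

text \<open>Up to sign this is \<open>k! * l!\<close> times the beta integral of \<open>x^k * (1-x)^l\<close> over \<open>[0,1]\<close>.\<close>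

definition weight :: "nat \<Rightarrow> nat \<Rightarrow> 'a :: field_char_0" where
  "weight k l = (-1) ^ (k + l) * (fact k)\<^sup>2 * (fact l)\<^sup>2 / fact (k + l + 1)"

lemma weight_eq_binomial:
  "weight k l = (-1) ^ (k + l) * fact k * fact l / (of_nat (k + l + 1) * of_nat ((k + l) choose l))"
  by (simp add: weight_def binomial_fact power2_eq_square field_simps)

text \<open>
  Both sides equal \<open>weight k l * (k * l - 1) / (k + l + 2)\<close>, which is symmetric in \<open>k\<close> and \<open>l\<close>.
\<close>

lemma weight_exchange:
  "of_nat k * weight k l + weight (Suc k) l
     = (of_nat l * weight k l + weight k (Suc l) :: 'a :: field_char_0)"
proof -
  have up: "weight (Suc k) l = - (of_nat (Suc k))\<^sup>2 / of_nat (k + l + 2) * (weight k l :: 'a)" for k l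
    by (simp add: weight_def power_mult_distrib)
  have sym: "weight k l = (weight l k :: 'a)" for k l
    by (simp add: weight_def add.commute mult.commute mult.left_commute)
  have step: "of_nat k * weight k l + weight (Suc k) l
          = weight k l * (of_nat k * of_nat l - 1) / (of_nat (k + l + 2) :: 'a)" for k l
  proof -
    have "of_nat (k + l + 2) \<noteq> (0 :: 'a)"
      by (metis of_nat_eq_0_iff add_is_0 zero_neq_numeral)
    thus ?thesis
      unfolding up by (simp add: field_simps power2_eq_square)
  qed
  show ?thesis
    using step[of k l] step[of l k] by (simp add: sym[of l k] sym[of "Suc l" k] add.commute mult.commute)
qed

definition Stirling_double_sum :: "nat \<Rightarrow> nat \<Rightarrow> 'a :: field_char_0" where
  "Stirling_double_sum n m =
     (\<Sum>k\<le>n. \<Sum>l\<le>m. of_nat (Stirling n k) * of_nat (Stirling m l) * weight k l)"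

lemma Stirling_double_sum_exchange:
  "Stirling_double_sum (Suc n) m = (Stirling_double_sum n (Suc m) :: 'a :: field_char_0)"
proof -
  let ?S = "\<lambda>n k. of_nat (Stirling n k) :: 'a"
  have nested: "Stirling_double_sum n m = (\<Sum>k\<le>n. ?S n k * (\<Sum>l\<le>m. ?S m l * weight k l))" for n m
    by (simp add: Stirling_double_sum_def sum_distrib_left mult.assoc)
  have "Stirling_double_sum (Suc n) m
          = (\<Sum>k\<le>n. ?S n k * (\<Sum>l\<le>m. ?S m l * (of_nat k * weight k l + weight (Suc k) l)))"
    unfolding nested sum_Stirling_Suc
    by (simp add: sum_distrib_left algebra_simps sum.distrib)
  also have "\<dots> = (\<Sum>k\<le>n. ?S n k * (\<Sum>l\<le>m. ?S m l * (of_nat l * weight k l + weight k (Suc l))))"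
    by (simp only: weight_exchange)
  also have "\<dots> = Stirling_double_sum n (Suc m)"
    unfolding nested sum_Stirling_Suc ..
  finally show ?thesis .
qed

section \<open>Bernoulli numbers as a double sum over Stirling numbers\<close>

lemma bernoulli_eq_Stirling_double_sum: "bernoulli (m + n) = Stirling_double_sum n m"
proof (induction m arbitrary: n)
  case 0
  show ?case
    by (simp add: bernoulli_eq_sum_Stirling Stirling_double_sum_def weight_eq_binomial mult_ac)
next
  case (Suc m)
  show ?case
    using Suc.IH[of "Suc n"] by (simp add: Stirling_double_sum_exchange)
qed

theorem theorem1:
  fixes m n :: nat
  shows "bernoulli (m + n) =
    (\<Sum>k\<in>{0..n}. \<Sum>l\<in>{0..m}.
      ((-1) ^ (k + l) * fact k * fact l * of_nat (Stirling n k) * of_nat (Stirling m l))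
        / (of_nat (k + l + 1) * of_nat ((k + l) choose l)))"
  unfolding bernoulli_eq_Stirling_double_sum Stirling_double_sum_def weight_eq_binomial atLeast0AtMost
  by (intro sum.cong refl) simp

end
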